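(* Assume the 3x+1 conjecture holds (every positive integer reaches $1$ under iteration of the Collatz function $C$). Let $N$ be a positive integer with $O(N)\le 512$. Then $\mathrm{Res}(N)<2$.
   Context: The Collatz function on positive integers is $C(N)=3N+1$ if $N$ is odd and $C(N)=N/2$ if $N$ is even. For a positive integer $N$ whose iterates under $C$ reach $1$, iterate $C$ from $N$ until $1$ is reached for the first time (zero steps if $N=1$). $O(N)$ is the number of odd steps (steps applying $C$ to an odd integer) and $E(N)$ is the number of even steps (steps applying $C$ to an even integer). The Residue of $N$ is $\mathrm{Res}(N)=\dfrac{2^{E(N)}}{3^{O(N)}\cdot N}$. *)

theory Defs
  imports Complex_Main
begin

definition collatz :: "nat \<Rightarrow> nat" where
  "collatz n = (if odd n then 3 * n + 1 else n div 2)"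

definition reaches_one :: "nat \<Rightarrow> bool" where
  "reaches_one n \<longleftrightarrow> (\<exists>k. (collatz ^^ k) n = 1)"

definition collatz_conjecture :: bool where
  "collatz_conjecture \<longleftrightarrow> (\<forall>n>0. reaches_one n)"

(* Number of steps until 1 is reached for the first time (0 if n = 1).
   Like the notions built on it, it is meaningful only if reaches_one n. *)
definition stopping_steps :: "nat \<Rightarrow> nat" where
  "stopping_steps n = (LEAST k. (collatz ^^ k) n = 1)"

definition odd_steps :: "nat \<Rightarrow> nat" where
  "odd_steps n = card {i. i < stopping_steps n \<and> odd ((collatz ^^ i) n)}"

definition even_steps :: "nat \<Rightarrow> nat" where
  "even_steps n = card {i. i < stopping_steps n \<and> even ((collatz ^^ i) n)}"

definition Res :: "nat \<Rightarrow> real" where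
  "Res n = 2 ^ even_steps n / (3 ^ odd_steps n * real n)"

end

theory Submission imports Defs begin

text \<open>
  Each odd step at \<open>n\<close> contributes a factor \<open>1 + 1 / (3 * n)\<close> to the residue, so the residue is the
  product of these factors over the odd numbers met before \<open>1\<close>. These numbers are distinct, and
  at most one of them, \<open>m\<close>, is a multiple of 3, since a multiple of 3 has only multiples
  of 3 as predecessors, all of them even. The other factors are at most the
  product over the first 512 numbers \<open>5, 7, 11, 13, \<dots>, 1537\<close> coprime to 6, which is below
  \<open>1.973\<close>; this leaves room for a factor \<open>1 + 1 / (3 * m)\<close> with \<open>m \<ge> 27\<close>. The orbits of
  \<open>m = 3, 9, 15, 21\<close> are short.
\<close>

section \<open>Collatz iterates and divisibility by 3\<close>

lemma collatz_pos: "n > 0 \<Longrightarrow> collatz n > 0"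
  by (auto simp: collatz_def elim: evenE)

lemma collatz_funpow_pos: "n > 0 \<Longrightarrow> (collatz ^^ k) n > 0"
  by (induction k) (auto simp: collatz_pos)

text \<open>\<open>3 * n + 1\<close> is 1 modulo 3, and halving cannot create a factor 3.\<close>

lemma not_3_dvd_collatz:
  assumes "odd n \<or> \<not> 3 dvd n"
  shows "\<not> 3 dvd collatz n"
proof (cases "odd n")
  case True
  then show ?thesis by (simp add: collatz_def) presburger
next
  case False
  with assms show ?thesis by (simp add: collatz_def) presburger
qed

text \<open>The first step from an odd number leaves the multiples of 3, and no later step can
  return to them.\<close>

lemma not_3_dvd_collatz_funpow_Suc: "odd n \<Longrightarrow> \<not> 3 dvd (collatz ^^ Suc k) n"
  by (induction k) (auto simp: not_3_dvd_collatz)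

lemma collatz_funpow_split:
  assumes "i \<le> j"
  shows "(collatz ^^ j) n = (collatz ^^ (j - i)) ((collatz ^^ i) n)"
  using assms by (simp flip: funpow_add comp_apply[of "collatz ^^ (j - i)"])

section \<open>The residue as a product over odd steps\<close>

definition residue_factor :: "nat \<Rightarrow> real" where
  "residue_factor n = 1 + 1 / (3 * real n)"

lemma residue_factor_ge_1: "residue_factor n \<ge> 1"
  by (simp add: residue_factor_def)

lemma residue_factor_antimono: "0 < m \<Longrightarrow> m \<le> n \<Longrightarrow> residue_factor n \<le> residue_factor m"
  by (simp add: residue_factor_def frac_le)

text \<open>An odd step at \<open>x\<close> multiplies the iterate by
  \<open>3 * residue_factor x\<close>, an even step halves it. Counting up to an arbitrary
  \<open>k\<close> rather than the stopping time is what permits induction.\<close>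

lemma collatz_funpow_eq_prod:
  assumes "n > 0"
  shows "real ((collatz ^^ k) n) * 2 ^ card {i. i < k \<and> even ((collatz ^^ i) n)}
       = real n * 3 ^ card {i. i < k \<and> odd ((collatz ^^ i) n)}
         * (\<Prod>i | i < k \<and> odd ((collatz ^^ i) n). residue_factor ((collatz ^^ i) n))"
proof (induction k)
  case 0
  then show ?case by simp
next
  case (Suc k)
  let ?x = "(collatz ^^ k) n"
  have pos: "?x > 0"
    using assms by (rule collatz_funpow_pos)
  show ?case
  proof (cases "even ?x")
    case True
    then have "{i. i < Suc k \<and> even ((collatz ^^ i) n)} = insert k {i. i < k \<and> even ((collatz ^^ i) n)}"
      and odds: "{i. i < Suc k \<and> odd ((collatz ^^ i) n)} = {i. i < k \<and> odd ((collatz ^^ i) n)}"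
      by (auto simp: less_Suc_eq)
    then have "card {i. i < Suc k \<and> even ((collatz ^^ i) n)} = Suc (card {i. i < k \<and> even ((collatz ^^ i) n)})"
      by simp
    moreover have "real ((collatz ^^ Suc k) n) * 2 = real ?x"
      using True by (auto simp: collatz_def elim: evenE)
    ultimately show ?thesis
      unfolding odds using Suc.IH by (simp add: mult.assoc[symmetric])
  next
    case False
    then have odds: "{i. i < Suc k \<and> odd ((collatz ^^ i) n)} = insert k {i. i < k \<and> odd ((collatz ^^ i) n)}"
      and evens: "{i. i < Suc k \<and> even ((collatz ^^ i) n)} = {i. i < k \<and> even ((collatz ^^ i) n)}"
      by (auto simp: less_Suc_eq)
    have "real ((collatz ^^ Suc k) n) = 3 * residue_factor ?x * real ?x"
      using False pos by (simp add: collatz_def residue_factor_def field_simps)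
    then show ?thesis
      unfolding odds evens using Suc.IH by (simp add: mult_ac)
  qed
qed

section \<open>Odd numbers met before 1\<close>

definition odd_orbit :: "nat \<Rightarrow> nat set" where
  "odd_orbit n = (\<lambda>i. (collatz ^^ i) n) ` {i. i < stopping_steps n \<and> odd ((collatz ^^ i) n)}"

lemma finite_odd_orbit: "finite (odd_orbit n)"
  by (simp add: odd_orbit_def)

lemma collatz_funpow_neq_1: "i < stopping_steps n \<Longrightarrow> (collatz ^^ i) n \<noteq> 1"
  unfolding stopping_steps_def by (rule not_less_Least)

lemma collatz_funpow_stopping_steps: "reaches_one n \<Longrightarrow> (collatz ^^ stopping_steps n) n = 1"
  unfolding reaches_one_def stopping_steps_def by (rule LeastI_ex)

text \<open>A repeated value would make the orbit reach 1 already before the stopping time.\<close>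

lemma inj_on_collatz_funpow:
  assumes "reaches_one n"
  shows "inj_on (\<lambda>i. (collatz ^^ i) n) {..<stopping_steps n}"
proof (rule linorder_inj_onI)
  fix i j
  assume "i < j" and "j \<in> {..<stopping_steps n}"
  then have le: "j < stopping_steps n" by simp
  let ?d = "stopping_steps n - j"
  show "(collatz ^^ i) n \<noteq> (collatz ^^ j) n"
  proof
    assume eq: "(collatz ^^ i) n = (collatz ^^ j) n"
    have "(collatz ^^ (?d + i)) n = (collatz ^^ (?d + j)) n"
      by (simp add: funpow_add eq)
    also have "\<dots> = 1"
      using collatz_funpow_stopping_steps[OF assms] le by simp
    finally show False
      using collatz_funpow_neq_1[of "?d + i" n] le \<open>i < j\<close> by linarith
  qed
qed auto

lemma card_odd_orbit:
  assumes "reaches_one n"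
  shows "card (odd_orbit n) = odd_steps n"
  unfolding odd_orbit_def odd_steps_def
  by (intro card_image inj_on_subset[OF inj_on_collatz_funpow[OF assms]]) auto

text \<open>At the stopping time the iterate in \<open>collatz_funpow_eq_prod\<close> is 1.
  Injectivity then replaces step indices by values, so that the product can be compared with
  products over fixed sets of integers.\<close>

lemma Res_eq_prod:
  assumes "n > 0" and "reaches_one n"
  shows "Res n = (\<Prod>m\<in>odd_orbit n. residue_factor m)"
proof -
  have "inj_on (\<lambda>i. (collatz ^^ i) n) {i. i < stopping_steps n \<and> odd ((collatz ^^ i) n)}"
    by (rule inj_on_subset[OF inj_on_collatz_funpow[OF assms(2)]]) auto
  then have "(\<Prod>m\<in>odd_orbit n. residue_factor m)
    = (\<Prod>i | i < stopping_steps n \<and> odd ((collatz ^^ i) n). residue_factor ((collatz ^^ i) n))"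
    unfolding odd_orbit_def by (simp add: prod.reindex)
  then have "2 ^ even_steps n = real n * 3 ^ odd_steps n * (\<Prod>m\<in>odd_orbit n. residue_factor m)"
    using collatz_funpow_eq_prod[OF assms(1), of "stopping_steps n"]
    by (simp add: collatz_funpow_stopping_steps[OF assms(2)] odd_steps_def even_steps_def)
  then show ?thesis
    using assms(1) by (simp add: Res_def)
qed

lemma odd_orbit_gt_1:
  assumes "n > 0" and "m \<in> odd_orbit n"
  shows "odd m" and "m > 1"
proof -
  obtain i where i: "i < stopping_steps n" "odd m" "m = (collatz ^^ i) n"
    using assms(2) by (auto simp: odd_orbit_def)
  then show "odd m" by simp
  show "m > 1"
    using collatz_funpow_neq_1[OF i(1)] collatz_funpow_pos[OF assms(1), of i] i(3) by linarith
qed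

text \<open>If an odd \<open>l\<close> came strictly before \<open>m\<close>, then \<open>m\<close>
  would be a later iterate of an odd number and hence no multiple of 3. So the whole odd orbit lies
  on the forward orbit of \<open>m\<close>.\<close>

lemma odd_orbit_after_3_dvd:
  assumes "m \<in> odd_orbit n" and "3 dvd m" and "l \<in> odd_orbit n"
  shows "\<exists>k. l = (collatz ^^ k) m"
proof -
  obtain i where i: "odd m" "m = (collatz ^^ i) n"
    using assms(1) by (auto simp: odd_orbit_def)
  obtain j where j: "odd l" "l = (collatz ^^ j) n"
    using assms(3) by (auto simp: odd_orbit_def)
  have "i \<le> j"
  proof (rule ccontr)
    assume "\<not> i \<le> j"
    then obtain k where k: "i - j = Suc k" and "j \<le> i"
      by (metis Suc_diff_Suc nat_le_linear not_le)
    then have "m = (collatz ^^ Suc k) l"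
      using collatz_funpow_split[of j i n] i(2) j(2) by simp
    then show False
      using not_3_dvd_collatz_funpow_Suc[OF j(1)] assms(2) by blast
  qed
  then show ?thesis
    using collatz_funpow_split[of i j n] i(2) j(2) by blast
qed

lemma odd_orbit_3_dvd_unique:
  assumes "m \<in> odd_orbit n" and "3 dvd m" and "l \<in> odd_orbit n" and "3 dvd l"
  shows "l = m"
proof -
  obtain k where k: "l = (collatz ^^ k) m"
    using odd_orbit_after_3_dvd[OF assms(1,2,3)] by blast
  have "odd m" using assms(1) by (auto simp: odd_orbit_def)
  then show ?thesis
    using k assms(4) not_3_dvd_collatz_funpow_Suc[of m] by (cases k) auto
qed

section \<open>Orbits of small multiples of 3\<close>

text \<open>The union of the orbits of 3, 9, 15 and 21.\<close>

definition small_orbits :: "nat set" where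
  "small_orbits = {1, 2, 3, 4, 5, 7, 8, 9, 10, 11, 13, 14, 15, 16, 17, 20, 21, 22, 23, 26, 28,
     32, 34, 35, 40, 46, 52, 53, 64, 70, 80, 106, 160}"

text \<open>The set is closed under \<open>collatz\<close>: it contains the cycle 1, 4, 2, so
  running past 1 does no harm.\<close>

lemma collatz_funpow_small_orbits: "m \<in> small_orbits \<Longrightarrow> (collatz ^^ k) m \<in> small_orbits"
proof (induction k)
  case (Suc k)
  have "collatz l \<in> small_orbits" if "l \<in> small_orbits" for l
    using that unfolding small_orbits_def collatz_def by (elim insertE emptyE) simp_all
  with Suc show ?case by simp
qed simp

lemma prod_small_orbits:
  assumes "S \<subseteq> small_orbits" and "\<And>m. m \<in> S \<Longrightarrow> odd m \<and> m > 1"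
  shows "(\<Prod>m\<in>S. residue_factor m) < 2"
proof -
  \<comment> \<open>The odd members of \<open>small_orbits\<close> other than 1. Adding factors that
    are at least 1 only enlarges the product, and even the full product stays below 2.\<close>
  let ?U = "{3, 5, 7, 9, 11, 13, 15, 17, 21, 23, 35, 53} :: nat set"
  have "S \<subseteq> ?U"
  proof
    fix m assume "m \<in> S"
    with assms have "m \<in> small_orbits" "odd m" "m > 1" by auto
    then show "m \<in> ?U"
      unfolding small_orbits_def by (elim insertE emptyE) simp_all
  qed
  then have "(\<Prod>m\<in>S. residue_factor m) \<le> (\<Prod>m\<in>?U. residue_factor m)"
    by (intro prod_mono2)
      (use residue_factor_ge_1 in \<open>auto intro: order_trans[OF zero_le_one]\<close>)
  also have "\<dots> < 2"
    by (simp add: residue_factor_def)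
  finally show ?thesis .
qed

section \<open>Comparing products by exchange of factors\<close>

lemma prod_le_prod_threshold:
  fixes f :: "'a \<Rightarrow> 'b :: linordered_idom"
  assumes "finite S" "finite A" "card S \<le> card A" "c \<ge> 1"
    and nonneg: "\<And>x. x \<in> S \<Longrightarrow> f x \<ge> 0"
    and le: "\<And>x. x \<in> S - A \<Longrightarrow> f x \<le> c"
    and ge: "\<And>x. x \<in> A - S \<Longrightarrow> f x \<ge> c"
  shows "prod f S \<le> prod f A"
proof -
  \<comment> \<open>Apart from the common part, factors at most \<open>c\<close> are exchanged for
    at least as many factors at least \<open>c\<close>; since \<open>c \<ge> 1\<close>, surplus
    factors do not hurt.\<close>
  have card: "card (S - A) \<le> card (A - S)"
    using assms(1-3) card_Diff_subset_Int[of S A] card_Diff_subset_Int[of A S]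
    by (simp add: Int_commute)
  have "prod f (S - A) \<le> c ^ card (S - A)"
    using prod_mono[of "S - A" f "\<lambda>_. c"] nonneg le by simp
  also have "\<dots> \<le> c ^ card (A - S)"
    using card \<open>c \<ge> 1\<close> by (rule power_increasing)
  also have "\<dots> \<le> prod f (A - S)"
    using prod_mono[of "A - S" "\<lambda>_. c" f] ge \<open>c \<ge> 1\<close> by simp
  finally have "prod f (S \<inter> A) * prod f (S - A) \<le> prod f (S \<inter> A) * prod f (A - S)"
    by (intro mult_left_mono prod_nonneg) (use nonneg in auto)
  moreover have "prod f S = prod f (S \<inter> A) * prod f (S - A)"
    using prod.Int_Diff[OF assms(1)] .
  moreover have "prod f A = prod f (S \<inter> A) * prod f (A - S)"
    using prod.Int_Diff[OF assms(2), of f S] by (simp add: Int_commute)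
  ultimately show ?thesis by simp
qed

section \<open>Numerical bound for the first 512 numbers coprime to 6\<close>

text \<open>Fixed-point upper bound, in units of \<open>10\<^sup>-\<^sup>7\<close> and rounded up at each step, for the product of
  the factors at \<open>6 * k + 5\<close> and \<open>6 * k + 7\<close>; tail recursive so that it can be run.\<close>

fun scaled_prod :: "int \<Rightarrow> int \<Rightarrow> nat \<Rightarrow> int" where
  "scaled_prod u k 0 = u"
| "scaled_prod u k (Suc n) = scaled_prod (u * ((18 * k + 16) * (18 * k + 22)) div ((18 * k + 15) * (18 * k + 21)) + 1) (k + 1) n"

lemma scaled_prod_ge:
  assumes "u \<ge> 0"
  shows "real_of_int u * (\<Prod>i = k..<k + n. residue_factor (6 * i + 5) * residue_factor (6 * i + 7))
    \<le> scaled_prod u (int k) n"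
  using assms
proof (induction n arbitrary: u k)
  case 0
  then show ?case by simp
next
  case (Suc n)
  let ?g = "\<lambda>i. residue_factor (6 * i + 5) * residue_factor (6 * i + 7)"
  let ?a = "(18 * int k + 16) * (18 * int k + 22)" and ?b = "(18 * int k + 15) * (18 * int k + 21)"
  let ?v = "u * ?a div ?b + 1"
  have "?b > 0" and "?v \<ge> 0"
    using Suc.prems by (simp_all add: pos_imp_zdiv_nonneg_iff add_nonneg_nonneg)
  \<comment> \<open>\<open>3 * (6 * k + 5) = 18 * k + 15\<close> and
    \<open>3 * (6 * k + 7) = 18 * k + 21\<close>, so \<open>?a / ?b\<close> is exactly the pair of
    factors; floor plus 1 then bounds the quotient from above.\<close>
  have "real_of_int u * ?g k = real_of_int (u * ?a) / real_of_int ?b"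
    by (simp add: residue_factor_def field_simps)
  also have "\<dots> \<le> real_of_int ?v"
    using real_of_int_div3[of "u * ?a" ?b] by simp
  finally have "real_of_int u * ?g k \<le> real_of_int ?v" .
  moreover have "(\<Prod>i = Suc k..<Suc k + n. ?g i) \<ge> 0"
    by (intro prod_nonneg) (simp add: residue_factor_def)
  ultimately have "real_of_int u * ?g k * (\<Prod>i = Suc k..<Suc k + n. ?g i)
      \<le> real_of_int ?v * (\<Prod>i = Suc k..<Suc k + n. ?g i)"
    by (rule mult_right_mono)
  also have "\<dots> \<le> scaled_prod ?v (int (Suc k)) n"
    using \<open>?v \<ge> 0\<close> by (rule Suc.IH)
  finally have "real_of_int u * (?g k * (\<Prod>i = Suc k..<k + Suc n. ?g i))
      \<le> scaled_prod ?v (int k + 1) n"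
    by (simp only: mult.assoc add_Suc add_Suc_right of_nat_Suc add.commute[of 1])
  moreover have "(\<Prod>i = k..<k + Suc n. ?g i) = ?g k * (\<Prod>i = Suc k..<k + Suc n. ?g i)"
    by (rule prod.atLeast_Suc_lessThan) simp
  ultimately show ?case
    by (simp only: scaled_prod.simps)
qed

text \<open>The split into two classes modulo 6 matches the paired factors in
  \<open>scaled_prod\<close>.\<close>

definition coprime_6_initial :: "nat set" where
  "coprime_6_initial = (\<lambda>k. 6 * k + 5) ` {0..<256} \<union> (\<lambda>k. 6 * k + 7) ` {0..<256}"

lemma coprime_6_initial_disjoint:
  "(\<lambda>k::nat. 6 * k + 5) ` A \<inter> (\<lambda>k. 6 * k + 7) ` B = {}"
proof -
  have "6 * k + 5 \<noteq> 6 * l + 7" for k l :: nat by presburger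
  then show ?thesis by blast
qed

lemma card_coprime_6_initial: "card coprime_6_initial = 512"
  unfolding coprime_6_initial_def
  by (subst card_Un_disjoint) (simp_all add: coprime_6_initial_disjoint card_image inj_on_def)

lemma prod_coprime_6_initial: "(\<Prod>m\<in>coprime_6_initial. residue_factor m) \<le> 1973 / 1000"
proof -
  have "(\<Prod>m\<in>coprime_6_initial. residue_factor m)
      = (\<Prod>k = 0..<256. residue_factor (6 * k + 5) * residue_factor (6 * k + 7))"
    unfolding coprime_6_initial_def
    by (subst prod.union_disjoint)
      (simp_all add: coprime_6_initial_disjoint prod.reindex inj_on_def prod.distrib)
  moreover have "scaled_prod (10 ^ 7) 0 256 \<le> 1973 * 10 ^ 4"
    by code_simp
  ultimately show ?thesis
    using scaled_prod_ge[of "10 ^ 7" 0 256] by simp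
qed

lemma mem_coprime_6_initial:
  assumes "odd m" "\<not> 3 dvd m" "m > 1" "m < 1541"
  shows "m \<in> coprime_6_initial"
proof -
  have "m mod 6 = 5 \<or> m mod 6 = 1"
    using assms(1,2) by presburger
  then show ?thesis
  proof
    assume "m mod 6 = 5"
    then have "m = 6 * (m div 6) + 5" "m div 6 < 256"
      using assms(4) by presburger+
    then show ?thesis unfolding coprime_6_initial_def by auto
  next
    assume "m mod 6 = 1"
    \<comment> \<open>Here \<open>m > 1\<close> forces \<open>m \<ge> 7\<close>, so the subtraction
      is not truncated.\<close>
    then have "m = 6 * (m div 6 - 1) + 7" "m div 6 - 1 < 256"
      using assms(3,4) by presburger+
    then show ?thesis unfolding coprime_6_initial_def by auto
  qed
qed

lemma prod_coprime_6_le: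
  assumes "finite S" "card S \<le> 512"
    and S: "\<And>m. m \<in> S \<Longrightarrow> odd m \<and> \<not> 3 dvd m \<and> m > 1"
  shows "(\<Prod>m\<in>S. residue_factor m) \<le> 1973 / 1000"
proof -
  have "(\<Prod>m\<in>S. residue_factor m) \<le> (\<Prod>m\<in>coprime_6_initial. residue_factor m)"
  proof (rule prod_le_prod_threshold)
    \<comment> \<open>1541 is the next number coprime to 6 after 1537, so its factor separates the
      initial set from all larger candidates.\<close>
    show "residue_factor m \<le> residue_factor 1541" if "m \<in> S - coprime_6_initial" for m
      using that S mem_coprime_6_initial[of m] by (intro residue_factor_antimono) force+
    show "residue_factor 1541 \<le> residue_factor m" if "m \<in> coprime_6_initial - S" for m
      using that by (intro residue_factor_antimono) (auto simp: coprime_6_initial_def)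
    show "residue_factor m \<ge> 0" for m
      using residue_factor_ge_1[of m] by linarith
    show "finite coprime_6_initial"
      by (simp add: coprime_6_initial_def)
  qed (use assms(1,2) in \<open>simp_all add: card_coprime_6_initial residue_factor_ge_1\<close>)
  with prod_coprime_6_initial show ?thesis by linarith
qed

theorem corollary3p6:
  fixes N :: nat
  assumes "collatz_conjecture"
    and "N > 0"
    and "odd_steps N \<le> 512"
  shows "Res N < 2"
proof -
  have reach: "reaches_one N"
    using assms(1,2) by (simp add: collatz_conjecture_def)
  let ?S = "odd_orbit N"
  have card: "card ?S \<le> 512"
    using assms(3) by (simp add: card_odd_orbit[OF reach])
  note odd_gt_1 = odd_orbit_gt_1[OF assms(2)]
  have "(\<Prod>m\<in>?S. residue_factor m) < 2"
  proof (cases "\<exists>m\<in>?S. 3 dvd m")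
    case False
    then have "(\<Prod>m\<in>?S. residue_factor m) \<le> 1973 / 1000"
      using odd_gt_1 card by (intro prod_coprime_6_le) (auto simp: finite_odd_orbit)
    then show ?thesis by simp
  next
    case True
    then obtain m where m: "m \<in> ?S" "3 dvd m" by blast
    show ?thesis
    \<comment> \<open>27 is the first odd multiple of 3 whose factor the bound 1.973 can absorb:
      82/81 * 1.973 is below 2, while 64/63 * 1.973, for \<open>m = 21\<close>, exceeds 2.\<close>
    proof (cases "m < 27")
      case True
      have "m = 3 \<or> m = 9 \<or> m = 15 \<or> m = 21"
        using True m(2) odd_gt_1(1)[OF m(1)] by presburger
      then have "m \<in> small_orbits"
        by (auto simp: small_orbits_def)
      then have "?S \<subseteq> small_orbits"
        using odd_orbit_after_3_dvd[OF m] collatz_funpow_small_orbits by blast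
      then show ?thesis
        using odd_gt_1 by (intro prod_small_orbits) auto
    next
      case False
      have "(\<Prod>l\<in>?S - {m}. residue_factor l) \<le> 1973 / 1000"
      proof (rule prod_coprime_6_le)
        show "card (?S - {m}) \<le> 512"
          using card card_Diff1_le[of ?S m] by linarith
        show "odd l \<and> \<not> 3 dvd l \<and> l > 1" if "l \<in> ?S - {m}" for l
          using that odd_gt_1 odd_orbit_3_dvd_unique[OF m] by blast
      qed (simp add: finite_odd_orbit)
      moreover have "residue_factor m \<le> residue_factor 27"
        using False by (intro residue_factor_antimono) auto
      ultimately have "residue_factor m * (\<Prod>l\<in>?S - {m}. residue_factor l)
          \<le> residue_factor 27 * (1973 / 1000)"
        by (intro mult_mono prod_nonneg) (auto simp: residue_factor_def)
      also have "\<dots> < 2"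
        by (simp add: residue_factor_def)
      finally show ?thesis
        using prod.remove[OF finite_odd_orbit m(1), of residue_factor] by simp
    qed
  qed
  then show ?thesis
    by (simp add: Res_eq_prod[OF assms(2) reach])
qed

end
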